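(* Let $H$ be the quaternion algebra over the field $\mathbb{R}$ of real numbers. If $a\in\mathbb{R}$ and $a<0$, then the equation $$x^2=a$$ has infinitely many roots $x\in H$.
   Context: $H$ is the usual algebra of quaternions $x^0+x^1i+x^2j+x^3k$ with real coefficients, and $\mathbb{R}$ is identified with the subalgebra of quaternions with $x^1=x^2=x^3=0$ (superscripts are coordinate indices). *)

theory Defs
  imports Complex_Main
begin

text \<open>
  \<^term>\<open>Quat a b c d\<close> stands for $a + b i + c j + d k$.
\<close>

datatype quat = Quat (q0: real) (q1: real) (q2: real) (q3: real)

lemma quat_eq_iff: "x = y \<longleftrightarrow> q0 x = q0 y \<and> q1 x = q1 y \<and> q2 x = q2 y \<and> q3 x = q3 y"
  by (cases x; cases y) simp

instantiation quat :: real_vector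
begin

definition zero_quat :: quat where "0 = Quat 0 0 0 0"

definition plus_quat :: "quat \<Rightarrow> quat \<Rightarrow> quat" where
  "x + y = Quat (q0 x + q0 y) (q1 x + q1 y) (q2 x + q2 y) (q3 x + q3 y)"

definition uminus_quat :: "quat \<Rightarrow> quat" where
  "- x = Quat (- q0 x) (- q1 x) (- q2 x) (- q3 x)"

definition minus_quat :: "quat \<Rightarrow> quat \<Rightarrow> quat" where
  "x - y = Quat (q0 x - q0 y) (q1 x - q1 y) (q2 x - q2 y) (q3 x - q3 y)"

definition scaleR_quat :: "real \<Rightarrow> quat \<Rightarrow> quat" where
  "r *\<^sub>R x = Quat (r * q0 x) (r * q1 x) (r * q2 x) (r * q3 x)"

instance
  by standard (simp_all add: zero_quat_def plus_quat_def uminus_quat_def minus_quat_def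
      scaleR_quat_def algebra_simps)

end

text \<open>
  The product is the bilinear extension of Hamilton's relations; see the lemmas
  \<open>quat_units_mult\<close> and \<open>quat_expand\<close> below.
\<close>

instantiation quat :: real_algebra_1
begin

definition one_quat :: quat where "1 = Quat 1 0 0 0"

definition times_quat :: "quat \<Rightarrow> quat \<Rightarrow> quat" where
  "x * y = Quat
     (q0 x * q0 y - q1 x * q1 y - q2 x * q2 y - q3 x * q3 y)
     (q0 x * q1 y + q1 x * q0 y + q2 x * q3 y - q3 x * q2 y)
     (q0 x * q2 y - q1 x * q3 y + q2 x * q0 y + q3 x * q1 y)
     (q0 x * q3 y + q1 x * q2 y - q2 x * q1 y + q3 x * q0 y)"

instance
  by standard (simp_all add: zero_quat_def plus_quat_def scaleR_quat_def one_quat_def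
      times_quat_def algebra_simps)

end

definition quat_i :: quat where "quat_i = Quat 0 1 0 0"
definition quat_j :: quat where "quat_j = Quat 0 0 1 0"
definition quat_k :: quat where "quat_k = Quat 0 0 0 1"

lemma quat_units_mult:
  "quat_i * quat_i = - 1" "quat_j * quat_j = - 1" "quat_k * quat_k = - 1"
  "quat_i * quat_j = quat_k" "quat_j * quat_k = quat_i" "quat_k * quat_i = quat_j"
  "quat_j * quat_i = - quat_k" "quat_k * quat_j = - quat_i" "quat_i * quat_k = - quat_j"
  by (simp_all add: quat_i_def quat_j_def quat_k_def times_quat_def one_quat_def uminus_quat_def)

text \<open>
  The library embedding \<^const>\<open>of_real\<close> of the reals in a unital real algebra is the
  identification of the reals with the quaternions whose last three coordinates vanish.
\<close>

lemma of_real_quat: "(of_real r :: quat) = Quat r 0 0 0"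
  by (simp add: of_real_def scaleR_quat_def one_quat_def)

lemma range_of_real_quat:
  "range (of_real :: real \<Rightarrow> quat) = {x. q1 x = 0 \<and> q2 x = 0 \<and> q3 x = 0}"
  by (auto simp: of_real_quat quat_eq_iff image_iff)

lemma quat_expand:
  "Quat a b c d = of_real a + of_real b * quat_i + of_real c * quat_j + of_real d * quat_k"
  by (simp add: of_real_quat quat_i_def quat_j_def quat_k_def plus_quat_def times_quat_def)

end

theory Submission
  imports Defs
begin

text \<open>
  A purely imaginary quaternion squares to minus the square of its Euclidean length. Hence every
  point of the sphere of radius \<open>sqrt (- a)\<close> in the space of imaginary quaternions is a root of
  \<open>x\<^sup>2 = a\<close>. For \<open>a < 0\<close> this radius is positive, and already the quarter of the great circle in
  the plane of \<open>i\<close> and \<open>j\<close> lying in the positive quadrant contains one root for every real number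
  between \<open>0\<close> and \<open>- a\<close>.
\<close>

text \<open>
  The mixed terms of the square cancel because the units \<open>i\<close>, \<open>j\<close>, \<open>k\<close> anticommute.
\<close>

lemma imaginary_quat_square:
  "(Quat 0 b c d)\<^sup>2 = of_real (- (b\<^sup>2 + c\<^sup>2 + d\<^sup>2))"
  by (simp add: power2_eq_square times_quat_def of_real_quat)

theorem corollary5p3:
  fixes a :: real
  assumes "a < 0"
  shows "infinite {x :: quat. x\<^sup>2 = of_real a}"
proof -
  \<comment> \<open>The arc is parametrised by the square of the \<open>i\<close>-coordinate; the \<open>j\<close>-coordinate then makes
    the squared length equal to \<open>- a\<close>.\<close>
  define root :: "real \<Rightarrow> quat" where "root s = Quat 0 (sqrt s) (sqrt (- a - s)) 0" for s
  have "inj_on root {0..- a}"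
    by (rule inj_onI) (simp add: root_def)
  moreover have "infinite {0..- a}"
    using assms by simp
  ultimately have "infinite (root ` {0..- a})"
    by (simp add: finite_image_iff)
  moreover have "root ` {0..- a} \<subseteq> {x. x\<^sup>2 = of_real a}"
    by (auto simp: root_def imaginary_quat_square)
  ultimately show ?thesis
    by (rule infinite_super[rotated])
qed

end
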